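(* Let $K\geq 1$, $C=\{1,\ldots,K\}$ and $C^+=\{0\}\cup C$, and let $(\Delta_{V,j})_{j\in C^+}$ and $(\Delta_{*,j})_{j\in C^+}$ be real numbers with $\Delta_{V,0}=\Delta_{*,0}=0$. Let $\varepsilon_C=\max_{j\in C^+}|\Delta_{V,j}-\Delta_{*,j}|$, $j^*\in\arg\max_{j\in C^+}\Delta_{*,j}$, and $\hat j_V\in\arg\max_{j\in C^+}\Delta_{V,j}$. Then $$\mathrm{ISR}(\hat j_V)\leq 2\varepsilon_C,$$ where $\mathrm{ISR}(\hat j)=\max_{j\in C^+}\Delta_{*,j}-\Delta_{*,\hat j}$ for $\hat j\in C^+$. Moreover, if $j^*$ is the unique maximizer of $\Delta_{*,j}$ over $C^+$ and $m=\Delta_{*,j^*}-\max_{k\in C^+,\,k\neq j^*}\Delta_{*,k}$, then $$m>2\varepsilon_C\ \Longrightarrow\ \hat j_V=j^*.$$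
   Context: $C$ indexes candidate policy updates of an incumbent policy, and index $0$ is the no-update action (keeping the incumbent). $\Delta_{V,j}$ is the improvement over the incumbent of candidate $j$ as estimated by a verifier, and $\Delta_{*,j}$ is its deployment improvement; these are arbitrary real numbers, with both equal to $0$ for $j=0$. $\mathrm{ISR}$ stands for improvement-selection regret. *)

theory Defs
  imports Complex_Main
begin

definition candidates :: "nat \<Rightarrow> nat set" where
  "candidates K = {1..K}"

definition candidates_plus :: "nat \<Rightarrow> nat set" where
  "candidates_plus K = {0} \<union> candidates K"

definition eps_C :: "nat \<Rightarrow> (nat \<Rightarrow> real) \<Rightarrow> (nat \<Rightarrow> real) \<Rightarrow> real" where
  "eps_C K DV DS = (MAX j\<in>candidates_plus K. \<bar>DV j - DS j\<bar>)"

(* Improvement-selection regret of selecting j, where DS is the deployment improvement. *)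
definition ISR :: "nat \<Rightarrow> (nat \<Rightarrow> real) \<Rightarrow> nat \<Rightarrow> real" where
  "ISR K DS j = (MAX i\<in>candidates_plus K. DS i) - DS j"

(* The maximum ranges over a nonempty set whenever K is at least 1. *)
definition margin :: "nat \<Rightarrow> (nat \<Rightarrow> real) \<Rightarrow> nat \<Rightarrow> real" where
  "margin K DS j = DS j - (MAX k\<in>candidates_plus K - {j}. DS k)"

end

theory Submission
  imports Defs
begin

text \<open>Verifier and deployment values differ by at most \<open>eps_C\<close> at every index.
  Comparing a competitor with the verifier's choice uses this twice, once at each of the two
  indices, while the verifier's own ranking favours its choice; hence the factor 2 in
  \<open>ISR_arg_max_le\<close>. Conversely, selecting anything other than a given index costs a
  regret of at least the margin of that index (\<open>margin_le_ISR\<close>), so a margin above the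
  regret bound leaves no other choice.\<close>

lemma finite_candidates_plus: "finite (candidates_plus K)"
  by (simp add: candidates_plus_def candidates_def)

lemma abs_diff_le_eps_C:
  assumes "j \<in> candidates_plus K"
  shows "\<bar>DV j - DS j\<bar> \<le> eps_C K DV DS"
  unfolding eps_C_def using assms by (intro Max_ge) (auto simp: finite_candidates_plus)

lemma ISR_arg_max_le:
  assumes "is_arg_max DV (\<lambda>j. j \<in> candidates_plus K) v"
  shows "ISR K DS v \<le> 2 * eps_C K DV DS"
proof -
  have v: "v \<in> candidates_plus K"
    using assms by (simp add: is_arg_max_def)
  have "DS i \<le> DS v + 2 * eps_C K DV DS" if i: "i \<in> candidates_plus K" for i
  proof -
    have "DV i \<le> DV v"
      using assms i by (auto simp: is_arg_max_def not_less)
    \<comment> \<open>With e = \<open>eps_C K DV DS\<close>, the chain is \<open>DS i\<close> \<le>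
      \<open>DV i\<close> + e \<le> \<open>DV v\<close> + e \<le> \<open>DS v\<close> + 2e.\<close>
    then show ?thesis
      using abs_diff_le_eps_C[OF i, of DV DS] abs_diff_le_eps_C[OF v, of DV DS] by linarith
  qed
  then have "(MAX i\<in>candidates_plus K. DS i) \<le> DS v + 2 * eps_C K DV DS"
    \<comment> \<open>The index \<open>v\<close> also witnesses that the set under the maximum is
      nonempty.\<close>
    using v by (subst Max_le_iff) (auto simp: finite_candidates_plus)
  then show ?thesis
    by (simp add: ISR_def)
qed

text \<open>As \<open>v\<close> competes in the maximum over indices other than \<open>s\<close>,
  the margin is at most \<open>DS s - DS v\<close>, and the best deployment value is at least
  \<open>DS s\<close>.\<close>

lemma margin_le_ISR:
  assumes "s \<in> candidates_plus K" "v \<in> candidates_plus K" "v \<noteq> s"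
  shows "margin K DS s \<le> ISR K DS v"
proof -
  have "DS v \<le> (MAX k\<in>candidates_plus K - {s}. DS k)"
    using assms by (intro Max_ge) (auto simp: finite_candidates_plus)
  moreover have "DS s \<le> (MAX i\<in>candidates_plus K. DS i)"
    using assms by (intro Max_ge) (auto simp: finite_candidates_plus)
  ultimately show ?thesis
    by (simp add: margin_def ISR_def)
qed

theorem proposition4:
  fixes K :: nat
    and \<Delta>\<^sub>V \<Delta>\<^sub>S :: "nat \<Rightarrow> real"
    and j\<^sub>S j\<^sub>V :: nat
  assumes "K \<ge> 1"
    and "\<Delta>\<^sub>V 0 = 0"
    and "\<Delta>\<^sub>S 0 = 0"
    and "is_arg_max \<Delta>\<^sub>S (\<lambda>j. j \<in> candidates_plus K) j\<^sub>S"
    and "is_arg_max \<Delta>\<^sub>V (\<lambda>j. j \<in> candidates_plus K) j\<^sub>V"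
  shows "ISR K \<Delta>\<^sub>S j\<^sub>V \<le> 2 * eps_C K \<Delta>\<^sub>V \<Delta>\<^sub>S \<and>
    ((\<forall>k. is_arg_max \<Delta>\<^sub>S (\<lambda>j. j \<in> candidates_plus K) k \<longrightarrow> k = j\<^sub>S) \<longrightarrow>
      margin K \<Delta>\<^sub>S j\<^sub>S > 2 * eps_C K \<Delta>\<^sub>V \<Delta>\<^sub>S \<longrightarrow> j\<^sub>V = j\<^sub>S)"
proof (intro conjI impI)
  show regret: "ISR K \<Delta>\<^sub>S j\<^sub>V \<le> 2 * eps_C K \<Delta>\<^sub>V \<Delta>\<^sub>S"
    using assms(5) by (rule ISR_arg_max_le)
  assume large: "margin K \<Delta>\<^sub>S j\<^sub>S > 2 * eps_C K \<Delta>\<^sub>V \<Delta>\<^sub>S"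
  have "j\<^sub>S \<in> candidates_plus K" "j\<^sub>V \<in> candidates_plus K"
    using assms(4,5) by (simp_all add: is_arg_max_def)
  \<comment> \<open>If the two indices differed, the margin would be at most the regret, hence at
    most twice \<open>eps_C\<close>, against \<open>large\<close>.\<close>
  then show "j\<^sub>V = j\<^sub>S"
    using margin_le_ISR[of j\<^sub>S K j\<^sub>V \<Delta>\<^sub>S] regret large by fastforce
qed

end
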